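(* Let $\mathsf P$ be any piece with three or more basic moves, on the square board $[0,1]^2$. Then the denominators $D_q(\mathsf P)$ increase at least exponentially in $q$; specifically, $D_q(\mathsf P)\ge \tfrac12\phi^{q/2}$ for all $q\ge12$, where $\phi=\frac{1+\sqrt5}{2}$ is the golden ratio.
   Context: A piece $\mathsf P$ is given by a finite set of basic moves: nonzero vectors $(c,d)\in\mathbb Z^2$ with $\gcd(c,d)=1$, no one a scalar multiple of another. For $q$ pieces, configurations are points $\mathbf z=(z_1,\dots,z_q)\in\mathbb R^{2q}$; for each basic move $(c,d)$ and $1\le i<j\le q$ the move hyperplane is $\{\mathbf z:(z_j-z_i)\cdot(d,-c)=0\}$, forming $\mathcal A^q_{\mathsf P}$. A vertex of the inside-out polytope $([0,1]^{2q},\mathcal A^q_{\mathsf P})$ is a point of $[0,1]^{2q}$ that is the unique point of an intersection of move hyperplanes and facet hyperplanes $x_i=0$, $x_i=1$, $y_i=0$, $y_i=1$. $D_q(\mathsf P)$ is the least common multiple, over all vertices, of the least common denominator of the vertex's coordinates. *)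

theory Defs
  imports "HOL-Analysis.Analysis"
begin

text \<open>Scalars are real: no basic move is a real (equivalently rational) multiple of another one.
  In particular a move and its negative do not both belong to a piece.\<close>

definition is_piece :: "(int \<times> int) set \<Rightarrow> bool" where
  "is_piece M \<longleftrightarrow> finite M
     \<and> (\<forall>(c, d) \<in> M. (c, d) \<noteq> (0, 0) \<and> gcd c d = 1)
     \<and> (\<forall>(c, d) \<in> M. \<forall>(c', d') \<in> M. (c, d) \<noteq> (c', d') \<longrightarrow>
           \<not> (\<exists>t::real. real_of_int c' = t * real_of_int c \<and> real_of_int d' = t * real_of_int d))"

text \<open>The space of \<open>2 q\<close>-tuples of reals, as functions from the index set \<open>{1..q}\<close> to the plane.
  They are extensional (\<open>undefined\<close> outside \<open>{1..q}\<close>), so that equality of points is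
  equality of their coordinates.\<close>

definition config_space :: "nat \<Rightarrow> (nat \<Rightarrow> real \<times> real) set" where
  "config_space q = {1..q} \<rightarrow>\<^sub>E UNIV"

definition config_cube :: "nat \<Rightarrow> (nat \<Rightarrow> real \<times> real) set" where
  "config_cube q = {1..q} \<rightarrow>\<^sub>E ({0..1} \<times> {0..1})"

definition move_hyperplane ::
  "nat \<Rightarrow> int \<times> int \<Rightarrow> nat \<Rightarrow> nat \<Rightarrow> (nat \<Rightarrow> real \<times> real) set" where
  "move_hyperplane q m i j =
     {z \<in> config_space q. (z j - z i) \<bullet> (real_of_int (snd m), - real_of_int (fst m)) = 0}"

definition move_arrangement ::
  "nat \<Rightarrow> (int \<times> int) set \<Rightarrow> (nat \<Rightarrow> real \<times> real) set set" where
  "move_arrangement q M =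
     {move_hyperplane q m i j | m i j. m \<in> M \<and> 1 \<le> i \<and> i < j \<and> j \<le> q}"

definition facet_hyperplanes :: "nat \<Rightarrow> (nat \<Rightarrow> real \<times> real) set set" where
  "facet_hyperplanes q =
     {{z \<in> config_space q. fst (z i) = a} | i a. i \<in> {1..q} \<and> a \<in> {0, 1}}
   \<union> {{z \<in> config_space q. snd (z i) = a} | i a. i \<in> {1..q} \<and> a \<in> {0, 1}}"

text \<open>The intersection is taken in the whole space, not in the cube; intersecting with
  \<^term>\<open>config_space q\<close> only matters for the empty family \<open>S\<close>.\<close>

definition inside_out_vertices ::
  "nat \<Rightarrow> (int \<times> int) set \<Rightarrow> (nat \<Rightarrow> real \<times> real) set" where
  "inside_out_vertices q M =
     {z \<in> config_cube q.
        \<exists>S. S \<subseteq> move_arrangement q M \<union> facet_hyperplanes q \<and> config_space q \<inter> \<Inter>S = {z}}"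

text \<open>Least common denominator of the coordinates; it is only meaningful at rational points,
  and all vertices are rational, being unique solutions of rational linear systems.\<close>

definition config_denominator :: "nat \<Rightarrow> (nat \<Rightarrow> real \<times> real) \<Rightarrow> nat" where
  "config_denominator q z =
     (LEAST n. 0 < n \<and> (\<forall>i\<in>{1..q}. real n * fst (z i) \<in> \<int> \<and> real n * snd (z i) \<in> \<int>))"

text \<open>The set of vertices is finite, because there are finitely many hyperplanes. Hence this
  is never the conventional value \<open>0\<close> of \<^const>\<open>Lcm\<close> on infinite sets.\<close>

definition piece_denominator :: "nat \<Rightarrow> (int \<times> int) set \<Rightarrow> nat" where
  "piece_denominator q M = Lcm (config_denominator q ` inside_out_vertices q M)"

end

(*
  Take three moves, rescaled to directions e_0, e_1, e_2 with sum 0, extended periodically, and let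
  v_k = F_k e_{k+1} + F_{k+1} e_k. Then v_k - v_{k+1} = 2 F_{k+1} e_k and
  v_k + v_{k+1} = 2 F_k e_{k+1}, so the pair of pieces at v_{k+1} and -v_{k+1} is determined, through
  move lines only, by the pair at v_k and -v_k. Placing the pieces at v_1, -v_1, ..., v_n, -v_n with
  n = q div 2 thus gives a configuration that is rigid up to translation and scaling; fitting it
  into the square, so that it touches two opposite sides and one more, gives a vertex.

  If N is a denominator of this vertex and 2 E is the size of the bounding box, then N e_l / E is an
  integer vector for all l. With the three moves ordered so that the x-coordinates of e_n and e_{n+1}
  do not have opposite signs and that of e_n is nonzero, N >= N |x(v_n)| / E >= F_{n+1}.

  The least common multiple is a genuine upper bound because there are finitely many vertices and
  all of them are rational: a Q-linear map of the reals that fixes 1 maps solutions of the defining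
  system to solutions, so it fixes the coordinates of a unique solution.
*)

theory Submission
  imports Defs "HOL-Number_Theory.Fib"
begin

section \<open>Rationality and finiteness of the vertices\<close>

text \<open>An irrational x is independent of 1 over the rationals, so some rational-linear map
  fixes 1 and sends x to 0.\<close>

lemma Rats_if_fixed_by_rat_linear:
  fixes x :: real
  assumes fixed: "\<And>g :: real \<Rightarrow> real. (\<And>a b. g (a + b) = g a + g b) \<Longrightarrow>
    (\<And>r a. g (of_rat r * a) = of_rat r * g a) \<Longrightarrow> g 1 = 1 \<Longrightarrow> g x = x"
  shows "x \<in> \<rat>"
proof (rule ccontr)
  assume x: "x \<notin> \<rat>"
  interpret V: vector_space "\<lambda>(r::rat) (a::real). of_rat r * a"
    by unfold_locales (auto simp: algebra_simps of_rat_add of_rat_mult)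
  interpret VP: vector_space_pair "\<lambda>(r::rat) (a::real). of_rat r * a"
      "\<lambda>(r::rat) (a::real). of_rat r * a" ..
  have one: "V.independent {1}"
    by simp
  have "x \<notin> V.span {1}"
    using x by (auto simp: V.span_singleton)
  with one have ind: "V.independent {x, 1}"
    by (simp add: V.independent_insertI)
  obtain g where g: "Vector_Spaces.linear (\<lambda>(r::rat) (a::real). of_rat r * a)
      (\<lambda>(r::rat) (a::real). of_rat r * a) g"
    and val: "\<forall>a\<in>{x, 1}. g a = (if a = 1 then 1 else 0)"
    using VP.linear_independent_extend[OF ind, of "\<lambda>a. if a = 1 then 1 else 0"] by blast
  interpret L: Vector_Spaces.linear "\<lambda>(r::rat) (a::real). of_rat r * a"
      "\<lambda>(r::rat) (a::real). of_rat r * a" g by (rule g)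
  have "g x = x"
    using val by (intro fixed) (auto simp: L.add L.scale)
  moreover have "x \<noteq> 1" "x \<noteq> 0"
    using x by auto
  ultimately show False
    using val by auto
qed

lemma vertex_rational:
  assumes "z \<in> inside_out_vertices q M" and i: "i \<in> {1..q}"
  shows "fst (z i) \<in> \<rat>" and "snd (z i) \<in> \<rat>"
proof -
  obtain S where S: "S \<subseteq> move_arrangement q M \<union> facet_hyperplanes q"
    and uniq: "config_space q \<inter> \<Inter>S = {z}"
    using assms(1) by (auto simp: inside_out_vertices_def)
  have fixed: "g (fst (z i)) = fst (z i) \<and> g (snd (z i)) = snd (z i)"
    if add: "\<And>a b. g (a + b) = g a + g b"
      and scale: "\<And>r a. g (of_rat r * a) = of_rat r * g a" and one: "g 1 = 1"
    for g :: "real \<Rightarrow> real"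
  proof -
    define z' where "z' = restrict (\<lambda>i. map_prod g g (z i)) {1..q}"
    have int: "g (of_int k * a) = of_int k * g a" for k a
      using scale[of "of_int k" a] by simp
    have zero: "g 0 = 0"
      using add[of 0 0] by simp
    have diff: "g (a - b) = g a - g b" for a b
      using add[of "a - b" b] by simp
    have space: "z' \<in> config_space q"
      by (simp add: z'_def config_space_def)
    \<comment> \<open>Move equations are homogeneous with integer coefficients, facet equations have
      constants 0 or 1; g respects both.\<close>
    have "z' \<in> H" if "H \<in> S" for H
    proof -
      have zH: "z \<in> H" using uniq that by auto
      consider "H \<in> move_arrangement q M" | "H \<in> facet_hyperplanes q"
        using S \<open>H \<in> S\<close> by auto
      then show ?thesis
      proof cases
        case 1
        then obtain c d i j where H: "H = move_hyperplane q (c, d) i j"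
          and ij: "1 \<le> i" "i < j" "j \<le> q"
          by (auto simp: move_arrangement_def)
        have "of_int d * (fst (z j) - fst (z i)) - of_int c * (snd (z j) - snd (z i)) = 0"
          using zH by (auto simp: H move_hyperplane_def inner_prod_def algebra_simps)
        then have "g (of_int d * (fst (z j) - fst (z i)) - of_int c * (snd (z j) - snd (z i))) = 0"
          using zero by simp
        then have "of_int d * (g (fst (z j)) - g (fst (z i)))
            - of_int c * (g (snd (z j)) - g (snd (z i))) = 0"
          by (simp only: diff int)
        then show ?thesis
          using ij space
          by (auto simp: H move_hyperplane_def inner_prod_def algebra_simps z'_def)
      next
        case 2
        then show ?thesis
          using zH space zero one by (auto simp: facet_hyperplanes_def z'_def)
      qed
    qed
    then have "z' = z" using space uniq by auto
    then have "z' i = z i" by simp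
    then show ?thesis
      using i by (auto simp: z'_def map_prod_def split: prod.splits)
  qed
  show "fst (z i) \<in> \<rat>" "snd (z i) \<in> \<rat>"
    using fixed by (auto intro: Rats_if_fixed_by_rat_linear)
qed

lemma common_denominator_exists:
  fixes A :: "real set"
  assumes "finite A" "A \<subseteq> \<rat>"
  shows "\<exists>n::nat. 0 < n \<and> (\<forall>x\<in>A. real n * x \<in> \<int>)"
  using assms
proof (induction A)
  case empty
  show ?case by auto
next
  case (insert x A)
  then obtain n :: nat where n: "0 < n" "\<forall>x\<in>A. real n * x \<in> \<int>" by auto
  obtain a b where x: "x = of_int a / of_int b" "b > 0"
    using insert.prems by (auto elim: Rats_cases')
  have "real (n * nat b) * y \<in> \<int>" if "y \<in> insert x A" for y
  proof (cases "y = x")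
    case True
    then have "real (n * nat b) * y = of_int (int n * a)"
      using x by simp
    then show ?thesis by (metis Ints_of_int)
  next
    case False
    then have "real n * y \<in> \<int>" using n that by auto
    then have "of_int b * (real n * y) \<in> \<int>" by (rule Ints_mult[OF Ints_of_int])
    moreover have "real (n * nat b) * y = of_int b * (real n * y)" using x by simp
    ultimately show ?thesis by (simp only:)
  qed
  moreover have "0 < n * nat b" using n x by simp
  ultimately show ?case by blast
qed

text \<open>By rationality a common denominator exists, so the \<open>LEAST\<close> value has the
  property it is chosen for.\<close>

lemma config_denominator_vertex:
  assumes "z \<in> inside_out_vertices q M"
  shows "0 < config_denominator q z"
    and "\<And>i. i \<in> {1..q} \<Longrightarrow> real (config_denominator q z) * fst (z i) \<in> \<int>
           \<and> real (config_denominator q z) * snd (z i) \<in> \<int>"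
proof -
  let ?P = "\<lambda>n::nat. 0 < n \<and> (\<forall>i\<in>{1..q}. real n * fst (z i) \<in> \<int> \<and> real n * snd (z i) \<in> \<int>)"
  have "\<exists>n. ?P n"
    using common_denominator_exists[of "(fst \<circ> z) ` {1..q} \<union> (snd \<circ> z) ` {1..q}"]
      vertex_rational[OF assms] by fastforce
  then have "?P (config_denominator q z)"
    unfolding config_denominator_def by (rule LeastI_ex)
  then show "0 < config_denominator q z"
    and "\<And>i. i \<in> {1..q} \<Longrightarrow> real (config_denominator q z) * fst (z i) \<in> \<int>
           \<and> real (config_denominator q z) * snd (z i) \<in> \<int>"
    by auto
qed

lemma finite_inside_out_vertices:
  assumes "finite M"
  shows "finite (inside_out_vertices q M)"
proof -
  let ?A = "move_arrangement q M \<union> facet_hyperplanes q"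
  have "move_arrangement q M
      \<subseteq> (\<lambda>(m, i, j). move_hyperplane q m i j) ` (M \<times> {1..q} \<times> {1..q})"
    by (force simp: move_arrangement_def)
  moreover have "facet_hyperplanes q
      \<subseteq> (\<lambda>(i, a). {z \<in> config_space q. fst (z i) = a}) ` ({1..q} \<times> {0, 1})
      \<union> (\<lambda>(i, a). {z \<in> config_space q. snd (z i) = a}) ` ({1..q} \<times> {0, 1})"
    by (force simp: facet_hyperplanes_def)
  ultimately have "finite ?A"
    using assms by (auto intro!: finite_subset[of "move_arrangement q M"]
      finite_subset[of "facet_hyperplanes q"])
  \<comment> \<open>A vertex is recovered from its family S as the only element of the
    intersection.\<close>
  moreover have "inside_out_vertices q M
      \<subseteq> (\<lambda>S. the_elem (config_space q \<inter> \<Inter>S)) ` Pow ?A"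
  proof
    fix z
    assume "z \<in> inside_out_vertices q M"
    then obtain S where S: "S \<in> Pow ?A" "config_space q \<inter> \<Inter>S = {z}"
      unfolding inside_out_vertices_def by blast
    then have "z = the_elem (config_space q \<inter> \<Inter>S)" by (simp only: the_elem_eq)
    with S(1) show "z \<in> (\<lambda>S. the_elem (config_space q \<inter> \<Inter>S)) ` Pow ?A"
      by (rule rev_image_eqI)
  qed
  ultimately show ?thesis
    by (meson finite_Pow_iff finite_imageI finite_subset)
qed

text \<open>A divisor is bounded by a nonzero multiple, and the \<open>Lcm\<close> of finitely many
  positive denominators is nonzero.\<close>

lemma piece_denominator_ge:
  assumes "finite M" and z: "z \<in> inside_out_vertices q M"
  shows "config_denominator q z \<le> piece_denominator q M"
proof -
  have "piece_denominator q M \<noteq> 0"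
    using finite_inside_out_vertices[OF assms(1), of q]
    by (auto simp: piece_denominator_def Lcm_0_iff dest: config_denominator_vertex(1))
  moreover have "config_denominator q z dvd piece_denominator q M"
    using z by (simp add: piece_denominator_def)
  ultimately show ?thesis
    by (simp add: dvd_imp_le)
qed

section \<open>Cross products in the plane\<close>

text \<open>The determinant: \<open>cross (z j - z i) (c, d) = 0\<close> is the equation of the move
  hyperplane for (c, d).\<close>

definition cross :: "real \<times> real \<Rightarrow> real \<times> real \<Rightarrow> real" where
  "cross a b = fst a * snd b - snd a * fst b"

lemma cross_add_left: "cross (a + b) c = cross a c + cross b c"
  and cross_diff_left: "cross (a - b) c = cross a c - cross b c"
  and cross_minus_left: "cross (- a) c = - cross a c"
  and cross_scaleR_left: "cross (t *\<^sub>R a) c = t * cross a c"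
  and cross_scaleR_right: "cross a (t *\<^sub>R c) = t * cross a c"
  and cross_self: "cross a a = 0"
  and cross_zero_left: "cross 0 a = 0"
  by (simp_all add: cross_def algebra_simps)

lemmas cross_simps = cross_add_left cross_diff_left cross_minus_left cross_scaleR_left
  cross_scaleR_right cross_self cross_zero_left

lemma cross_eq_0_imp_scaleR:
  assumes "cross r a = 0" "a \<noteq> 0"
  shows "\<exists>t. r = t *\<^sub>R a"
proof (cases "fst a = 0")
  case True
  then have "snd a \<noteq> 0" using assms(2) by (auto simp: prod_eq_iff)
  then show ?thesis
    using assms True by (intro exI[of _ "snd r / snd a"]) (auto simp: cross_def prod_eq_iff)
next
  case False
  then show ?thesis
    using assms
    by (intro exI[of _ "fst r / fst a"]) (auto simp: cross_def prod_eq_iff field_simps)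
qed

text \<open>Uniqueness of the meeting point of two lines with independent directions; r is the
  difference of two candidates.\<close>

lemma cross_eq_0_both:
  assumes "cross r a = 0" "cross r b = 0" "cross a b \<noteq> 0"
  shows "r = 0"
proof -
  have "a \<noteq> 0" using assms(3) by (auto simp: cross_def)
  then obtain t where "r = t *\<^sub>R a" using cross_eq_0_imp_scaleR assms(1) by blast
  with assms show ?thesis by (auto simp: cross_simps)
qed

section \<open>The spiral configuration and its rigidity\<close>

definition spiral :: "(nat \<Rightarrow> real \<times> real) \<Rightarrow> nat \<Rightarrow> real \<times> real" where
  "spiral e k = real (fib k) *\<^sub>R e (Suc k) + real (fib (Suc k)) *\<^sub>R e k"

text \<open>Pieces \<open>2 k - 1\<close> and \<open>2 k\<close> are at plus and minus the \<open>k\<close>-th spiral point. The minimum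
  matters only for an odd number of pieces: the last one then sits on top of piece \<open>2 n - 1\<close>.\<close>

definition piece_pos :: "(nat \<Rightarrow> real \<times> real) \<Rightarrow> nat \<Rightarrow> nat \<Rightarrow> real \<times> real" where
  "piece_pos e n i = (if even i then -1 else 1) *\<^sub>R spiral e (min n ((i + 1) div 2))"

text \<open>Nonzero real factors are allowed so that three moves can be rescaled to sum zero; they
  do not affect the move equations.\<close>

definition move_direction :: "(int \<times> int) set \<Rightarrow> real \<times> real \<Rightarrow> bool" where
  "move_direction M v \<longleftrightarrow> (\<exists>(c, d)\<in>M. \<exists>w. w \<noteq> 0 \<and> v = w *\<^sub>R (of_int c, of_int d))"

text \<open>The sum relation forces period 3, so e runs through only three vectors.\<close>

locale cyclic_directions =
  fixes e :: "nat \<Rightarrow> real \<times> real"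
  assumes sum_zero: "\<And>i. e i + e (Suc i) + e (Suc (Suc i)) = 0"
    and independent: "\<And>i. cross (e i) (e (Suc i)) \<noteq> 0"
begin

lemma step: "e (Suc (Suc i)) = - e i - e (Suc i)"
  using sum_zero[of i] by (metis add.commute add_eq_0_iff diff_conv_add_uminus minus_add_distrib)

text \<open>The Fibonacci recurrence leaves \<open>fib (Suc k)\<close> times e_k - e_{k+1} -
  e_{k+2}, which is 2 e_k because the three vectors sum to zero.\<close>

lemma spiral_diff: "spiral e k - spiral e (Suc k) = (2 * real (fib (Suc k))) *\<^sub>R e k"
  by (simp add: spiral_def step prod_eq_iff algebra_simps)

lemma spiral_add: "spiral e k + spiral e (Suc k) = (2 * real (fib k)) *\<^sub>R e (Suc k)"
  by (simp add: spiral_def step prod_eq_iff algebra_simps)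

lemma spiral_1: "spiral e (Suc 0) = - e 0"
  by (simp add: spiral_def step prod_eq_iff algebra_simps)

text \<open>By H, z has every alignment of the model configuration. The first pair fixes c and s;
  each later piece is the meeting point of two lines through the pair before it.\<close>

lemma rigid:
  assumes n: "n = q div 2" "n \<ge> 1"
    and H: "\<And>l i j. i \<in> {1..q} \<Longrightarrow> j \<in> {1..q} \<Longrightarrow>
      cross (piece_pos e n j - piece_pos e n i) (e l) = 0 \<Longrightarrow> cross (z j - z i) (e l) = 0"
  shows "\<exists>c s. \<forall>i\<in>{1..q}. z i = c + s *\<^sub>R piece_pos e n i"
proof -
  have odd_pos: "piece_pos e n (2 * k + 1) = spiral e (Suc k)"
    and even_pos: "piece_pos e n (2 * k + 2) = - spiral e (Suc k)" if "k < n" for k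
    using that by (simp_all add: piece_pos_def min_absorb2)
  have "2 \<le> q" using n by linarith
  then have "cross (z 2 - z 1) (e 0) = 0"
    using H[of 1 2 0] odd_pos[of 0] even_pos[of 0] n
    by (simp add: cross_simps spiral_1 numeral_2_eq_2)
  moreover have "e 0 \<noteq> 0" using independent[of 0] by (auto simp: cross_def)
  ultimately obtain t where t: "z 2 - z 1 = t *\<^sub>R e 0" using cross_eq_0_imp_scaleR by blast
  \<comment> \<open>Pieces 1 and 2 of the model are at - e_0 and e_0, so s is half of t and c is the
    midpoint.\<close>
  define s where "s = t / 2"
  define c where "c = z 1 + s *\<^sub>R e 0"
  have pair: "z (2 * k + 1) = c + s *\<^sub>R spiral e (Suc k) \<and>
      z (2 * k + 2) = c - s *\<^sub>R spiral e (Suc k)" if "k < n" for k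
    using that
  proof (induction k)
    case 0
    have "z 2 = z 1 + t *\<^sub>R e 0" using t by (metis add.commute diff_add_cancel)
    then show ?case
      by (simp add: c_def s_def spiral_1 prod_eq_iff numeral_2_eq_2)
  next
    case (Suc k)
    let ?a = "spiral e (Suc k)" and ?b = "spiral e (Suc (Suc k))"
    have k: "k < n" "Suc k < n" using Suc.prems by auto
    have IH: "z (2 * k + 1) = c + s *\<^sub>R ?a" "z (2 * k + 2) = c - s *\<^sub>R ?a"
      using Suc.IH k by auto
    have pos: "piece_pos e n (2 * k + 1) = ?a" "piece_pos e n (2 * k + 2) = - ?a"
      "piece_pos e n (2 * k + 3) = ?b" "piece_pos e n (2 * k + 4) = - ?b"
      using odd_pos[OF k(1)] even_pos[OF k(1)] odd_pos[OF k(2)] even_pos[OF k(2)]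
      by (simp_all add: numeral_eq_Suc)
    have in_range: "2 * k + 1 \<in> {1..q}" "2 * k + 2 \<in> {1..q}" "2 * k + 3 \<in> {1..q}"
      "2 * k + 4 \<in> {1..q}"
      using k n by auto
    \<comment> \<open>In consecutive pairs, pieces of equal sign are aligned along
      \<open>e (Suc k)\<close>, those of opposite sign along \<open>e (Suc (Suc k))\<close>.\<close>
    have d: "cross ?a (e (Suc k)) = cross ?b (e (Suc k))"
      using arg_cong[OF spiral_diff, of "\<lambda>x. cross x (e (Suc k))" "Suc k"]
      by (simp add: cross_simps)
    have a: "cross ?a (e (Suc (Suc k))) = - cross ?b (e (Suc (Suc k)))"
      using arg_cong[OF spiral_add, of "\<lambda>x. cross x (e (Suc (Suc k)))" "Suc k"]
      by (simp add: cross_simps)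
    have "z (2 * k + 3) - (c + s *\<^sub>R ?b) = 0"
    proof (rule cross_eq_0_both[OF _ _ independent[of "Suc k"]])
      show "cross (z (2 * k + 3) - (c + s *\<^sub>R ?b)) (e (Suc k)) = 0"
        using H[OF in_range(1,3), of "Suc k"] d
        unfolding pos IH by (simp add: cross_simps)
      show "cross (z (2 * k + 3) - (c + s *\<^sub>R ?b)) (e (Suc (Suc k))) = 0"
        using H[OF in_range(2,3), of "Suc (Suc k)"] a
        unfolding pos IH by (simp add: cross_simps)
    qed
    moreover have "z (2 * k + 4) - (c - s *\<^sub>R ?b) = 0"
    proof (rule cross_eq_0_both[OF _ _ independent[of "Suc k"]])
      show "cross (z (2 * k + 4) - (c - s *\<^sub>R ?b)) (e (Suc k)) = 0"
        using H[OF in_range(2,4), of "Suc k"] d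
        unfolding pos IH by (simp add: cross_simps)
      show "cross (z (2 * k + 4) - (c - s *\<^sub>R ?b)) (e (Suc (Suc k))) = 0"
        using H[OF in_range(1,4), of "Suc (Suc k)"] a
        unfolding pos IH by (simp add: cross_simps)
    qed
    ultimately show ?case by (simp add: numeral_eq_Suc)
  qed
  have small: "z i = c + s *\<^sub>R piece_pos e n i" if i: "1 \<le> i" "i \<le> 2 * n" for i
  proof (cases "even i")
    case True
    then obtain m where "i = 2 * m" by (elim evenE)
    moreover then obtain k where "m = Suc k" using i by (cases m) auto
    ultimately have "i = 2 * k + 2" by simp
    then show ?thesis using pair[of k] even_pos[of k] that by simp
  next
    case False
    then obtain k where "i = 2 * k + 1" by (elim oddE)
    then show ?thesis using pair[of k] odd_pos[of k] that by simp
  qed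
  have "z i = c + s *\<^sub>R piece_pos e n i" if "i \<in> {1..q}" for i
  proof (cases "i \<le> 2 * n")
    case True
    then show ?thesis using small that by auto
  next
    case False
    then have i: "i = 2 * n + 1" using that n by auto
    define j where "j = 2 * n - 1"
    have j: "1 \<le> j" "j \<le> 2 * n" "odd j" "j \<in> {1..q}" "(j + 1) div 2 = n"
      using n by (auto simp: j_def)
    have eq: "piece_pos e n i = piece_pos e n j"
      using j i by (simp add: piece_pos_def)
    \<comment> \<open>The model positions coincide, so H applies along two independent directions at
      once.\<close>
    have "z i - z j = 0"
      using H[OF j(4) that] independent[of 0]
      by (intro cross_eq_0_both[of _ "e 0" "e (Suc 0)"]) (simp_all add: eq cross_simps)
    then show ?thesis using small[OF j(1,2)] eq by simp
  qed
  then show ?thesis by blast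
qed

text \<open>Central symmetry, which centres the bounding box at the origin.\<close>

lemma piece_pos_opposite:
  assumes n: "n = q div 2" "n \<ge> 1" and i: "i \<in> {1..q}"
  shows "\<exists>j\<in>{1..q}. piece_pos e n j = - piece_pos e n i"
proof -
  define k where "k = min n ((i + 1) div 2)"
  have k: "1 \<le> k" "k \<le> n" using n i by (auto simp: k_def)
  define j where "j = (if even i then 2 * k - 1 else 2 * k)"
  have j: "(j + 1) div 2 = k" "even j \<longleftrightarrow> odd i"
    using k by (auto simp: j_def)
  have "piece_pos e n j = (if even j then -1 else 1) *\<^sub>R spiral e k"
    unfolding piece_pos_def j(1) using k by (simp add: min_absorb2)
  moreover have "piece_pos e n i = (if even i then -1 else 1) *\<^sub>R spiral e k"
    by (simp only: piece_pos_def k_def)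
  ultimately have "piece_pos e n j = - piece_pos e n i"
    using j(2) by simp
  moreover have "j \<in> {1..q}" using k n by (auto simp: j_def)
  ultimately show ?thesis by blast
qed

text \<open>Used for \<open>fst\<close> and \<open>snd\<close>, where X is half the width or half
  the height of the bounding box.\<close>

lemma piece_pos_extremes:
  fixes f :: "real \<times> real \<Rightarrow> real"
  assumes n: "n = q div 2" "n \<ge> 1" and f: "\<And>a. f (- a) = - f a"
  obtains X where "X \<ge> 0" "\<And>i. i \<in> {1..q} \<Longrightarrow> \<bar>f (piece_pos e n i)\<bar> \<le> X"
    "\<exists>i\<in>{1..q}. f (piece_pos e n i) = X" "\<exists>i\<in>{1..q}. f (piece_pos e n i) = - X"
proof -
  let ?g = "\<lambda>i. f (piece_pos e n i)"
  have q: "{1..q} \<noteq> {}" using n by auto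
  define X where "X = Max (?g ` {1..q})"
  have le: "?g i \<le> X" if "i \<in> {1..q}" for i
    using that by (simp add: X_def)
  have opp: "\<exists>j\<in>{1..q}. ?g j = - ?g i" if "i \<in> {1..q}" for i
    using piece_pos_opposite[OF n that] f by metis
  have abs: "\<bar>?g i\<bar> \<le> X" if i: "i \<in> {1..q}" for i
  proof -
    obtain j where "j \<in> {1..q}" "?g j = - ?g i" using opp[OF i] by blast
    then show ?thesis using le[OF i] le[of j] by simp
  qed
  have "X \<in> ?g ` {1..q}" unfolding X_def using q by (intro Max_in) auto
  then obtain i where i: "i \<in> {1..q}" "?g i = X" by auto
  obtain j where j: "j \<in> {1..q}" "?g j = - X" using opp[OF i(1)] i(2) by auto
  have "0 \<le> X" using abs[OF i(1)] by linarith
  then show thesis using that[of X] abs i j by blast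
qed

section \<open>The vertex and its denominator\<close>

text \<open>The sign condition excludes cancellation between the two terms of
  \<open>fst (spiral e n)\<close>.\<close>

lemma spiral_vertex:
  assumes n: "n = q div 2" "n \<ge> 2"
    and moves: "\<And>l. move_direction M (e l)"
    and sign: "fst (e n) \<noteq> 0" "fst (e n) * fst (e (Suc n)) \<ge> 0"
  shows "\<exists>z\<in>inside_out_vertices q M. fib (Suc n) \<le> config_denominator q z"
proof -
  define p where "p = piece_pos e n"
  have n1: "n \<ge> 1" using n by simp
  obtain X where X: "X \<ge> 0" "\<And>i. i \<in> {1..q} \<Longrightarrow> \<bar>fst (p i)\<bar> \<le> X"
    "\<exists>i\<in>{1..q}. fst (p i) = X" "\<exists>i\<in>{1..q}. fst (p i) = - X"
    using piece_pos_extremes[OF n(1) n1, of fst] by (auto simp: p_def)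
  obtain Y where Y: "Y \<ge> 0" "\<And>i. i \<in> {1..q} \<Longrightarrow> \<bar>snd (p i)\<bar> \<le> Y"
    "\<exists>i\<in>{1..q}. snd (p i) = Y" "\<exists>i\<in>{1..q}. snd (p i) = - Y"
    using piece_pos_extremes[OF n(1) n1, of snd] by (auto simp: p_def)
  define E where "E = max X Y"
  have abs_sum: "\<bar>x + y\<bar> = \<bar>x\<bar> + \<bar>y\<bar>" if "x * y \<ge> 0" for x y :: real
    using that by (auto simp: zero_le_mult_iff)
  have weighted: "real (fib (Suc n)) * \<bar>a\<bar> \<le> \<bar>real (fib n) * b + real (fib (Suc n)) * a\<bar>"
    if "a * b \<ge> 0" for a b :: real
  proof -
    have "0 \<le> (real (fib n) * real (fib (Suc n))) * (a * b)" using that by simp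
    then have "\<bar>real (fib n) * b + real (fib (Suc n)) * a\<bar>
        = \<bar>real (fib n) * b\<bar> + \<bar>real (fib (Suc n)) * a\<bar>"
      by (intro abs_sum) (simp add: mult_ac)
    then show ?thesis by (simp add: abs_mult)
  qed
  have n_pos: "p (2 * n) = - spiral e n"
    using n by (simp add: p_def piece_pos_def)
  have fst_spiral: "\<bar>fst (spiral e n)\<bar> \<le> X"
  proof -
    have "2 * n \<in> {1..q}" using n by auto
    from X(2)[OF this] show ?thesis by (simp add: n_pos)
  qed
  have "0 < real (fib (Suc n)) * \<bar>fst (e n)\<bar>"
    using sign by (simp add: fib_neq_0_nat)
  also have "\<dots> \<le> \<bar>fst (spiral e n)\<bar>"
    using weighted[OF sign(2)] by (simp add: spiral_def)
  finally have "0 < X" using fst_spiral by linarith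
  then have E: "E > 0" "X \<le> E" "Y \<le> E" by (auto simp: E_def)
  \<comment> \<open>Scales the longer side 2 E of the bounding box to 1; the shift by (t X, t Y)
    then puts its lower left corner at the origin.\<close>
  define t where "t = 1 / (2 * E)"
  have t: "t > 0" "t * E = 1 / 2" using E by (auto simp: t_def)
  define z where "z = restrict (\<lambda>i. (t * X, t * Y) + t *\<^sub>R p i) {1..q}"
  have zi: "z i = (t * X, t * Y) + t *\<^sub>R p i" if "i \<in> {1..q}" for i
    using that by (simp add: z_def)
  have space: "z \<in> config_space q" by (simp add: config_space_def z_def)
  have in_unit: "0 \<le> t * U + t * u \<and> t * U + t * u \<le> 1" if "\<bar>u\<bar> \<le> U" "U \<le> E" for u U
  proof -
    have "0 \<le> t * (U + u)" "t * (U + u) \<le> t * (2 * E)"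
      using that t by (auto intro!: mult_nonneg_nonneg mult_left_mono)
    then show ?thesis using t by (simp add: algebra_simps)
  qed
  have cube: "z \<in> config_cube q"
    using in_unit X(2) Y(2) E by (auto simp: config_cube_def z_def mem_Times_iff)
  \<comment> \<open>All hyperplanes through z are taken, so every relation of z carries over to
    z'.\<close>
  define S where "S = {H \<in> move_arrangement q M \<union> facet_hyperplanes q. z \<in> H}"
  have unique: "z' = z" if z': "z' \<in> config_space q" and inS: "\<And>H. H \<in> S \<Longrightarrow> z' \<in> H" for z'
  proof -
    have H: "cross (z' j - z' i) (e l) = 0"
      if ij: "i \<in> {1..q}" "j \<in> {1..q}" and 0: "cross (p j - p i) (e l) = 0" for i j l
    proof -
      obtain c d w where m: "(c, d) \<in> M" "w \<noteq> 0" "e l = w *\<^sub>R (of_int c, of_int d)"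
        using moves[of l] by (auto simp: move_direction_def)
      let ?m = "(of_int c, of_int d) :: real \<times> real"
      \<comment> \<open>Move hyperplanes come only with i < j; antisymmetry gives the reversed
        order.\<close>
      have lt: "cross (z' j - z' i) ?m = 0"
        if "i \<in> {1..q}" "j \<in> {1..q}" "cross (p j - p i) ?m = 0" "i < j" for i j
      proof -
        have "z j - z i = t *\<^sub>R (p j - p i)"
          using that by (simp add: zi scaleR_diff_right)
        then have "cross (z j - z i) ?m = 0" using that by (simp add: cross_scaleR_left)
        then have "z \<in> move_hyperplane q (c, d) i j"
          using space by (simp add: move_hyperplane_def inner_prod_def cross_def)
        then have "move_hyperplane q (c, d) i j \<in> S"
          using that m by (auto simp: S_def move_arrangement_def)
        then have "z' \<in> move_hyperplane q (c, d) i j" by (rule inS)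
        then show ?thesis by (simp add: move_hyperplane_def inner_prod_def cross_def)
      qed
      have p0: "cross (p j - p i) ?m = 0" using 0 m(2) unfolding m(3) cross_scaleR_right by simp
      consider "i < j" | "j < i" | "i = j" by linarith
      then have "cross (z' j - z' i) ?m = 0"
      proof cases
        case 1
        then show ?thesis using lt ij p0 by blast
      next
        case 2
        then show ?thesis using lt[of j i] ij p0 by (simp add: cross_diff_left)
      qed (simp add: cross_zero_left)
      then show ?thesis unfolding m(3) cross_scaleR_right by simp
    qed
    \<comment> \<open>Only c and s remain free. The left and bottom facets express c through s, and
      the far facet across a longest side fixes s.\<close>
    obtain c s where cs: "\<And>i. i \<in> {1..q} \<Longrightarrow> z' i = c + s *\<^sub>R p i"
      using rigid[OF n(1) n1, of z'] H unfolding p_def by blast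
    have fst_facet: "fst (z' i) = a" if "i \<in> {1..q}" "a \<in> {0, 1}" "fst (z i) = a" for i a
    proof -
      have "{z \<in> config_space q. fst (z i) = a} \<in> S"
        unfolding S_def facet_hyperplanes_def using that space by blast
      then show ?thesis using inS by blast
    qed
    have snd_facet: "snd (z' i) = a" if "i \<in> {1..q}" "a \<in> {0, 1}" "snd (z i) = a" for i a
    proof -
      have "{z \<in> config_space q. snd (z i) = a} \<in> S"
        unfolding S_def facet_hyperplanes_def using that space by blast
      then show ?thesis using inS by blast
    qed
    have left: "fst c = s * X"
    proof -
      obtain i where i: "i \<in> {1..q}" "fst (p i) = - X" using X(4) by blast
      then show ?thesis using fst_facet[of i 0] by (simp add: cs zi)
    qed
    have bottom: "snd c = s * Y"
    proof -
      obtain i where i: "i \<in> {1..q}" "snd (p i) = - Y" using Y(4) by blast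
      then show ?thesis using snd_facet[of i 0] by (simp add: cs zi)
    qed
    have "s * E = 1 / 2"
    proof (cases "X = E")
      case True
      obtain i where i: "i \<in> {1..q}" "fst (p i) = X" using X(3) by blast
      then show ?thesis using fst_facet[of i 1] left t True by (simp add: cs zi mult_ac)
    next
      case False
      then have "Y = E" by (auto simp: E_def)
      moreover obtain i where i: "i \<in> {1..q}" "snd (p i) = Y" using Y(3) by blast
      ultimately show ?thesis using snd_facet[of i 1] bottom t by (simp add: cs zi mult_ac)
    qed
    then have "s = t" using E by (simp add: t_def field_simps)
    then have "z' i = z i" if "i \<in> {1..q}" for i
      using that left bottom by (simp add: cs zi prod_eq_iff)
    then show ?thesis
      using z' space unfolding config_space_def by (metis PiE_ext)
  qed
  have vertex: "z \<in> inside_out_vertices q M"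
  proof -
    have "config_space q \<inter> \<Inter>S = {z}"
      using unique space by (auto simp: S_def)
    moreover have "S \<subseteq> move_arrangement q M \<union> facet_hyperplanes q"
      by (auto simp: S_def)
    ultimately show ?thesis
      using cube unfolding inside_out_vertices_def by blast
  qed
  define N where "N = config_denominator q z"
  have N: "real N * fst (z i) \<in> \<int>" if "i \<in> {1..q}" for i
    using config_denominator_vertex(2)[OF vertex that] by (simp add: N_def)
  \<comment> \<open>Differences among pieces 1, 2, 3 are e_0 / E and e_1 / E, since 2 t = 1 / E and
    \<open>fib 1 = fib 2 = 1\<close>; the sum relation gives the rest.\<close>
  have ints: "real N / E * fst (e l) \<in> \<int> \<and> real N / E * fst (e (Suc l)) \<in> \<int>" for l
  proof (induction l)
    case 0
    have q: "1 \<in> {1..q}" "2 \<in> {1..q}" "3 \<in> {1..q}" using n by auto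
    have p: "p 1 = spiral e (Suc 0)" "p 2 = - spiral e (Suc 0)" "p 3 = spiral e (Suc (Suc 0))"
      using n by (simp_all add: p_def piece_pos_def min_absorb2 flip: numeral_2_eq_2)
    have "fst (z 2) - fst (z 1) = 1 / E * fst (e 0)"
      unfolding zi[OF q(1)] zi[OF q(2)] p using E by (simp add: spiral_1 t_def)
    moreover have "fst (z 1) - fst (z 3) = t * fst (spiral e (Suc 0) - spiral e (Suc (Suc 0)))"
      unfolding zi[OF q(1)] zi[OF q(3)] p by (simp add: algebra_simps)
    then have "fst (z 1) - fst (z 3) = 1 / E * fst (e (Suc 0))"
      using E by (simp add: spiral_diff t_def)
    moreover have "real N * (fst (z 2) - fst (z 1)) \<in> \<int>"
      "real N * (fst (z 1) - fst (z 3)) \<in> \<int>"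
      using N q by (simp_all only: right_diff_distrib Ints_diff)
    ultimately show ?case by simp
  next
    case (Suc l)
    then have "- (real N / E * fst (e l)) - real N / E * fst (e (Suc l)) \<in> \<int>"
      by (intro Ints_diff Ints_minus) auto
    moreover have "real N / E * fst (e (Suc (Suc l)))
        = - (real N / E * fst (e l)) - real N / E * fst (e (Suc l))"
      by (simp add: step right_diff_distrib)
    ultimately show ?case using Suc by metis
  qed
  \<comment> \<open>In x-coordinates N v_n / E = F_n b + F_{n+1} a. The left side is at most N in
    absolute value, the right side at least F_{n+1}.\<close>
  define a b where "a = real N / E * fst (e n)" and "b = real N / E * fst (e (Suc n))"
  have N_pos: "N > 0" using config_denominator_vertex(1)[OF vertex] by (simp add: N_def)
  have "a \<in> \<int>" "a \<noteq> 0" using ints[of n] sign N_pos E by (auto simp: a_def)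
  then have "1 \<le> \<bar>a\<bar>" by (rule Ints_nonzero_abs_ge1)
  then have "real (fib (Suc n)) \<le> real (fib (Suc n)) * \<bar>a\<bar>"
    by (simp add: mult_le_cancel_left1)
  \<comment> \<open>Both numbers carry the factor N / E, so the sign hypothesis passes to their
    product.\<close>
  also have "a * b = (real N / E)\<^sup>2 * (fst (e n) * fst (e (Suc n)))"
    by (simp add: a_def b_def power2_eq_square)
  then have "a * b \<ge> 0" using sign(2) by (simp only: mult_nonneg_nonneg zero_le_power2)
  then have "real (fib (Suc n)) * \<bar>a\<bar> \<le> \<bar>real (fib n) * b + real (fib (Suc n)) * a\<bar>"
    by (rule weighted)
  also have "real (fib n) * b + real (fib (Suc n)) * a = real N / E * fst (spiral e n)"
    by (simp add: a_def b_def spiral_def algebra_simps add_divide_distrib)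
  also have "\<bar>\<dots>\<bar> = real N / E * \<bar>fst (spiral e n)\<bar>"
    using E by (simp add: abs_mult)
  also have "\<dots> \<le> real N / E * E"
    using fst_spiral E by (intro mult_left_mono) auto
  also have "\<dots> = real N" using E by simp
  finally show ?thesis using vertex by (auto simp: N_def)
qed

end

section \<open>Choice and order of three moves\<close>

lemma move_directions_exist:
  assumes M: "is_piece M" "card M \<ge> 3"
  obtains A B C where "move_direction M A" "move_direction M B" "move_direction M C"
    "A + B + C = 0" "cross A B \<noteq> 0" "fst A \<noteq> 0" "fst A * fst B \<ge> 0"
proof -
  define V where "V = (\<lambda>m::int \<times> int. (of_int (fst m), of_int (snd m)) :: real \<times> real)"
  have ind: "cross (V m) (V m') \<noteq> 0" if m: "m \<in> M" "m' \<in> M" "m \<noteq> m'" for m m'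
  proof
    assume "cross (V m) (V m') = 0"
    then have "cross (V m') (V m) = 0" by (simp add: cross_def algebra_simps)
    moreover have "V m \<noteq> 0"
      using M(1) m(1) by (fastforce simp: is_piece_def V_def prod_eq_iff)
    ultimately obtain t where "V m' = t *\<^sub>R V m" using cross_eq_0_imp_scaleR by blast
    then show False
      using M(1) m by (cases m; cases m') (force simp: is_piece_def V_def)
  qed
  obtain T where "T \<subseteq> M" "card T = 3" using M(2) by (meson obtain_subset_with_card_n)
  then obtain m0 m1 m2 where m: "m0 \<in> M" "m1 \<in> M" "m2 \<in> M"
    and ne: "m0 \<noteq> m1" "m1 \<noteq> m2" "m2 \<noteq> m0"
    by (auto simp: card_3_iff)
  \<comment> \<open>Coefficients from the planar identity cross(v,w) u + cross(w,u) v + cross(u,v) w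
    = 0.\<close>
  define A where "A = cross (V m1) (V m2) *\<^sub>R V m0"
  define B where "B = cross (V m2) (V m0) *\<^sub>R V m1"
  define C where "C = cross (V m0) (V m1) *\<^sub>R V m2"
  have w: "cross (V m1) (V m2) \<noteq> 0" "cross (V m2) (V m0) \<noteq> 0" "cross (V m0) (V m1) \<noteq> 0"
    using ind m ne by auto
  have PI: "move_direction M (r *\<^sub>R V m)" if "m \<in> M" "r \<noteq> 0" for r m
    using that unfolding move_direction_def V_def by (auto intro!: bexI[of _ m] split: prod.splits)
  have P: "move_direction M A" "move_direction M B" "move_direction M C"
    using w m PI by (auto simp: A_def B_def C_def)
  have sum: "A + B + C = 0"
    by (simp add: A_def B_def C_def cross_def prod_eq_iff algebra_simps)
  have AB: "cross A B \<noteq> 0" using w by (simp add: A_def B_def cross_simps)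
  \<comment> \<open>As the sum is zero, all these determinants agree up to sign, so independence
    survives reordering.\<close>
  have cyc: "cross B C = cross A B" "cross C A = cross A B" "cross B A = - cross A B"
    "cross C B = - cross A B" "cross A C = - cross A B"
  proof -
    have C: "C = - A - B" using sum by (simp add: prod_eq_iff)
    show "cross B C = cross A B" "cross C A = cross A B" "cross B A = - cross A B"
      "cross C B = - cross A B" "cross A C = - cross A B"
      unfolding C by (simp_all add: cross_def algebra_simps)
  qed
  have fst_sum: "fst A + fst B + fst C = 0"
    using arg_cong[OF sum, of fst] by simp
  have "fst A \<noteq> 0 \<or> fst B \<noteq> 0" using AB by (auto simp: cross_def)
  \<comment> \<open>If the x-coordinates of A and B have opposite signs, that of C is zero or shares
    its sign with one of them.\<close>
  then consider "fst A \<noteq> 0" "fst A * fst B \<ge> 0" | "fst B \<noteq> 0" "fst B * fst A \<ge> 0"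
    | "fst B \<noteq> 0" "fst B * fst C \<ge> 0" | "fst A \<noteq> 0" "fst A * fst C \<ge> 0"
    using fst_sum by (smt (verit) mult_nonneg_nonneg mult_nonpos_nonpos)
  then show thesis
  proof cases
    case 1
    then show thesis using that[of A B C] P sum AB by blast
  next
    case 2
    then show thesis using that[of B A C] P sum AB cyc by (simp add: add.commute)
  next
    case 3
    then show thesis using that[of B C A] P sum AB cyc by (simp add: add_ac)
  next
    case 4
    then show thesis using that[of A C B] P sum AB cyc by (simp add: add_ac)
  qed
qed

section \<open>The Fibonacci estimate and the final bound\<close>

text \<open>Both sides satisfy the Fibonacci recurrence in n, so n = 6 and n = 7 suffice. The factor
  \<open>sqrt \<phi>\<close> accounts for odd q.\<close>

lemma fib_Suc_lower_bound:
  fixes \<phi> :: real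
  defines "\<phi> \<equiv> (1 + sqrt 5) / 2"
  assumes "n \<ge> 6"
  shows "\<phi> ^ n * sqrt \<phi> \<le> 2 * real (fib (Suc n))"
proof -
  have sq: "\<phi> ^ 2 = \<phi> + 1" by (simp add: \<phi>_def power2_eq_square field_simps)
  have "sqrt 5 \<le> 2.24" by (rule real_le_lsqrt) (simp_all add: power2_eq_square)
  then have le: "\<phi> \<le> 1.62" by (simp add: \<phi>_def)
  have pos: "\<phi> > 0" by (simp add: \<phi>_def add_pos_nonneg)
  have "\<phi> \<le> 1.28\<^sup>2" using le by (simp add: power2_eq_square)
  then have root: "sqrt \<phi> \<le> 1.28" by (intro real_le_lsqrt) simp_all
  have p2: "\<phi> ^ Suc (Suc k) = \<phi> ^ Suc k + \<phi> ^ k" for k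
  proof -
    have "\<phi> ^ Suc (Suc k) = \<phi> ^ k * \<phi> ^ 2" by (simp add: power2_eq_square)
    then show ?thesis by (simp only: sq) (simp add: distrib_left)
  qed
  have p6: "\<phi> ^ 6 = 8 * \<phi> + 5" and p7: "\<phi> ^ 7 = 13 * \<phi> + 8"
    using p2[of 0] p2[of 1] p2[of 2] p2[of 3] p2[of 4] p2[of 5] by (simp_all add: eval_nat_numeral)
  have times_root: "\<phi> ^ k * sqrt \<phi> \<le> x * 1.28" if "\<phi> ^ k \<le> x" for k x
  proof -
    have "0 \<le> x" using that pos zero_le_power[of \<phi> k] by linarith
    then show ?thesis using that root pos by (intro mult_mono) auto
  qed
  have "\<phi> ^ n * sqrt \<phi> \<le> 2 * real (fib (Suc n)) \<and>
      \<phi> ^ Suc n * sqrt \<phi> \<le> 2 * real (fib (Suc (Suc n)))"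
    using \<open>n \<ge> 6\<close>
  proof (induction n rule: dec_induct)
    case base
    have "fib 7 = 13" "fib 8 = 21" by (simp_all add: eval_nat_numeral)
    \<comment> \<open>Numerically 18 * 1.28 = 23.04 < 26 and 30 * 1.28 = 38.4 < 42.\<close>
    then show ?case
      using times_root[of 6 18] times_root[of 7 30] p6 p7 le by simp
  next
    case (step n)
    then show ?case unfolding p2[of n] by (simp add: distrib_right)
  qed
  then show ?thesis by blast
qed

theorem theorem5p6:
  fixes M :: "(int \<times> int) set" and q :: nat
  assumes "is_piece M" and "card M \<ge> 3" and "q \<ge> 12"
  shows "real (piece_denominator q M) \<ge> 1 / 2 * ((1 + sqrt 5) / 2) powr (real q / 2)"
proof -
  define n where "n = q div 2"
  have n: "n \<ge> 6" using assms(3) by (simp add: n_def)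
  obtain A B C where P: "move_direction M A" "move_direction M B" "move_direction M C"
    and sum: "A + B + C = 0" and AB: "cross A B \<noteq> 0"
    and sign: "fst A \<noteq> 0" "fst A * fst B \<ge> 0"
    using move_directions_exist[OF assms(1,2)] by metis
  define T where "T = (\<lambda>r::nat. if r mod 3 = 0 then A else if r mod 3 = 1 then B else C)"
  \<comment> \<open>The shift by 2 n gives \<open>e n = T (3 * n) = A\<close> and
    \<open>e (Suc n) = B\<close>, so the sign condition holds at index n.\<close>
  define e where "e = (\<lambda>i. T (i + 2 * n))"
  have C: "C = - A - B" using sum by (simp add: prod_eq_iff)
  have T_step: "T r + T (Suc r) + T (Suc (Suc r)) = 0 \<and> cross (T r) (T (Suc r)) \<noteq> 0" for r
  proof -
    consider "r mod 3 = 0" | "r mod 3 = 1" | "r mod 3 = 2" by linarith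
    then show ?thesis
      using AB by cases (auto simp: T_def C mod_Suc cross_def algebra_simps)
  qed
  interpret cyclic_directions e
    by unfold_locales (use T_step in \<open>simp_all add: e_def\<close>)
  have en: "e n = A" "e (Suc n) = B"
    by (simp_all add: e_def T_def mod_Suc)
  have "\<exists>z\<in>inside_out_vertices q M. fib (Suc n) \<le> config_denominator q z"
  proof (rule spiral_vertex[OF n_def])
    show "move_direction M (e l)" for l
      using P by (simp add: e_def T_def)
  qed (use n sign in \<open>simp_all add: en\<close>)
  then have fib_le: "fib (Suc n) \<le> piece_denominator q M"
    using piece_denominator_ge assms(1) order_trans by (metis is_piece_def)
  let ?\<phi> = "(1 + sqrt 5) / 2 :: real"
  have phi: "?\<phi> \<ge> 1" by simp
  then have pos: "0 < ?\<phi>" by linarith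
  \<comment> \<open>Halving q with rounding loses at most 1/2 in the exponent.\<close>
  have "?\<phi> powr (real q / 2) \<le> ?\<phi> powr (real n + 1 / 2)"
    using phi by (intro powr_mono) (auto simp: n_def)
  also have "\<dots> = ?\<phi> ^ n * sqrt ?\<phi>"
    unfolding powr_add powr_realpow[OF pos] powr_half_sqrt[OF less_imp_le[OF pos]] ..
  also have "\<dots> \<le> 2 * real (fib (Suc n))"
    using fib_Suc_lower_bound[OF n] by simp
  also have "\<dots> \<le> 2 * real (piece_denominator q M)"
    using fib_le by simp
  finally show ?thesis by simp
qed

end
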